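(* Let $R$ be a commutative ring, $Q$ a finite quiver, $\overline{Q}$ its double, and $R\overline{Q}$ the path algebra of $\overline Q$. The double bracket $\{\!\{-,-\}\!\}^+:R\overline{Q}\otimes R\overline{Q}\to R\overline{Q}\otimes R\overline{Q}$ defined on arrows $a,b\in\overline{Q}_1$ by $$\{\!\{a,b\}\!\}^+=\langle a,b\rangle\, ba\otimes ab$$ is a Poisson double bracket.
   Context: The double $\overline{Q}$ of $Q=(s,t:Q_1\to Q_0)$ has the same vertices and arrows $Q_1\sqcup\{\overline{a}\mid a\in Q_1\}$, with $s(\overline{a})=t(a)$, $t(\overline{a})=s(a)$. Paths are read left to right: a path is a word $a_1\cdots a_n$ of arrows with $t(a_k)=s(a_{k+1})$; there is a constant path $e_i$ for each vertex $i$. $R\overline{Q}$ is the free $R$-module on paths with multiplication given by concatenation (zero if not composable); the $e_i$ are idempotents. The pairing $\langle-,-\rangle:\overline{Q}_1\times\overline{Q}_1\to\mathbb{Z}$ is $\langle a,b\rangle=1$ if $a\in Q_1$ and $b=\overline{a}$; $-1$ if $b\in Q_1$ and $a=\overline{b}$; $0$ otherwise. A double bracket on $A=R\overline Q$ (in the sense of Van den Bergh, relative to the subalgebra $\bigoplus_iRe_i$) is an $R$-bilinear map $\{\!\{-,-\}\!\}:A\times A\to A\otimes_R A$ with $\{\!\{x,y\}\!\}=-\{\!\{y,x\}\!\}^{\circ}$ where $(u\otimes v)^\circ=v\otimes u$; $\{\!\{x,yz\}\!\}=y\{\!\{x,z\}\!\}+\{\!\{x,y\}\!\}z$ for the outer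 bimodule structure $y(u\otimes v)z=yu\otimes vz$; and $\{\!\{x,e_i\}\!\}=0$. It is determined by its values on arrows. It is Poisson if the triple bracket $$\{\!\{x,y,z\}\!\}=\{\!\{x,\{\!\{y,z\}\!\}\}\!\}_L+\tau\{\!\{y,\{\!\{z,x\}\!\}\}\!\}_L+\tau^2\{\!\{z,\{\!\{x,y\}\!\}\}\!\}_L$$ vanishes identically, where $\{\!\{x,u\otimes v\}\!\}_L=\{\!\{x,u\}\!\}\otimes v$ and $\tau(u\otimes v\otimes w)=w\otimes u\otimes v$. *)

theory Defs
  imports
    "Graph_Theory.Arc_Walk"
    "HOL-Library.Poly_Mapping"
    "HOL-Library.FuncSet"
begin

section \<open>Free modules and their tensor products\<close>

text \<open>
  The free \<open>R\<close>-module on a set \<open>P\<close> consists of the finitely supported functions with support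
  in \<open>P\<close>. The tensor product of the free modules on \<open>P\<close> and \<open>P'\<close> is the free module on
  \<open>P \<times> P'\<close>, with \<open>p \<otimes> p'\<close> being the basis vector \<open>(p, p')\<close>; the lemma
  \<open>tensor_universal\<close> below gives its universal property for maps into free modules, and the
  \<open>_tensor\<close> lemmas check that the operations defined on basis vectors satisfy the intended
  formulas on all pure tensors.
\<close>

definition free_module :: "'p set \<Rightarrow> ('p \<Rightarrow>\<^sub>0 'r::comm_ring_1) set" where
  "free_module P = {x. Poly_Mapping.keys x \<subseteq> P}"

definition scale :: "'r::comm_ring_1 \<Rightarrow> ('p \<Rightarrow>\<^sub>0 'r) \<Rightarrow> ('p \<Rightarrow>\<^sub>0 'r)" where
  "scale r x = Poly_Mapping.map ((*) r) x"

definition basis :: "'p \<Rightarrow> ('p \<Rightarrow>\<^sub>0 'r::comm_ring_1)" where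
  "basis p = Poly_Mapping.single p 1"

definition linear_on :: "('p \<Rightarrow>\<^sub>0 'r::comm_ring_1) set \<Rightarrow> (('p \<Rightarrow>\<^sub>0 'r) \<Rightarrow> ('q \<Rightarrow>\<^sub>0 'r)) \<Rightarrow> bool" where
  "linear_on M f \<longleftrightarrow>
     (\<forall>x\<in>M. \<forall>y\<in>M. f (x + y) = f x + f y) \<and> (\<forall>r. \<forall>x\<in>M. f (scale r x) = scale r (f x))"

text \<open>The linear map with prescribed values on the basis vectors.\<close>

definition lin_ext :: "('p \<Rightarrow> ('q \<Rightarrow>\<^sub>0 'r)) \<Rightarrow> ('p \<Rightarrow>\<^sub>0 'r) \<Rightarrow> ('q \<Rightarrow>\<^sub>0 'r::comm_ring_1)" where
  "lin_ext f x = (\<Sum>p\<in>Poly_Mapping.keys x. scale (Poly_Mapping.lookup x p) (f p))"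

definition tensor :: "('p \<Rightarrow>\<^sub>0 'r) \<Rightarrow> ('q \<Rightarrow>\<^sub>0 'r) \<Rightarrow> ('p \<times> 'q \<Rightarrow>\<^sub>0 'r::comm_ring_1)"
    (infixl "\<otimes>" 70) where
  "x \<otimes> y = lin_ext (\<lambda>p. lin_ext (\<lambda>q. basis (p, q)) y) x"

definition flip :: "('p \<times> 'p \<Rightarrow>\<^sub>0 'r) \<Rightarrow> ('p \<times> 'p \<Rightarrow>\<^sub>0 'r::comm_ring_1)" where
  "flip = lin_ext (\<lambda>(p, q). basis (q, p))"

text \<open>Triple tensors are nested to the left.\<close>

definition rotate3 ::
    "(('p \<times> 'p) \<times> 'p \<Rightarrow>\<^sub>0 'r) \<Rightarrow> (('p \<times> 'p) \<times> 'p \<Rightarrow>\<^sub>0 'r::comm_ring_1)" where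
  "rotate3 = lin_ext (\<lambda>((p, q), r). basis ((r, p), q))"


section \<open>Quivers and path algebras\<close>

text \<open>
  A finite quiver is a \<^const>\<open>fin_digraph\<close>: loops and parallel arcs are allowed, the source of an
  arc is its \<^const>\<open>tail\<close> and the target its \<^const>\<open>head\<close>. In the double, \<open>Inl a\<close> stands
  for the arrow \<open>a\<close> and \<open>Inr a\<close> for its opposite.
\<close>

definition double :: "('v, 'a) pre_digraph \<Rightarrow> ('v, 'a + 'a) pre_digraph" where
  "double Q = \<lparr>verts = verts Q, arcs = arcs Q <+> arcs Q,
     tail = case_sum (tail Q) (head Q), head = case_sum (head Q) (tail Q)\<rparr>"

fun pairing :: "'a + 'a \<Rightarrow> 'a + 'a \<Rightarrow> int" where
  "pairing (Inl a) (Inr b) = (if a = b then 1 else 0)"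
| "pairing (Inr a) (Inl b) = (if a = b then -1 else 0)"
| "pairing _ _ = 0"

text \<open>Paths carry their end points, so that there is one constant path for each vertex.\<close>

type_synonym ('v, 'b) qpath = "'v \<times> 'b list \<times> 'v"
type_synonym ('v, 'b, 'r) palg = "('v, 'b) qpath \<Rightarrow>\<^sub>0 'r"
type_synonym ('v, 'b, 'r) palg2 = "('v, 'b) qpath \<times> ('v, 'b) qpath \<Rightarrow>\<^sub>0 'r"
type_synonym ('v, 'b, 'r) palg3 =
  "(('v, 'b) qpath \<times> ('v, 'b) qpath) \<times> ('v, 'b) qpath \<Rightarrow>\<^sub>0 'r"

definition paths :: "('v, 'b) pre_digraph \<Rightarrow> ('v, 'b) qpath set" where
  "paths G = {(u, p, v). pre_digraph.awalk G u p v}"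

definition path_algebra :: "('v, 'b) pre_digraph \<Rightarrow> ('v, 'b, 'r::comm_ring_1) palg set" where
  "path_algebra G = free_module (paths G)"

definition path_algebra2 :: "('v, 'b) pre_digraph \<Rightarrow> ('v, 'b, 'r::comm_ring_1) palg2 set" where
  "path_algebra2 G = free_module (paths G \<times> paths G)"

fun path_mult :: "('v, 'b) qpath \<Rightarrow> ('v, 'b) qpath \<Rightarrow> ('v, 'b, 'r::comm_ring_1) palg" where
  "path_mult (u, p, v) (u', p', v') = (if v = u' then basis (u, p @ p', v') else 0)"

definition mult :: "('v, 'b, 'r) palg \<Rightarrow> ('v, 'b, 'r) palg \<Rightarrow> ('v, 'b, 'r::comm_ring_1) palg"
    (infixl "\<cdot>" 75) where
  "x \<cdot> y = lin_ext (\<lambda>p. lin_ext (\<lambda>q. path_mult p q) y) x"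

definition vertex_elem :: "'v \<Rightarrow> ('v, 'b, 'r::comm_ring_1) palg" where
  "vertex_elem i = basis (i, [], i)"

definition arrow_elem ::
    "('v, 'b) pre_digraph \<Rightarrow> 'b \<Rightarrow> ('v, 'b, 'r::comm_ring_1) palg" where
  "arrow_elem G a = basis (tail G a, [a], head G a)"

text \<open>The outer bimodule structure on \<open>A \<otimes> A\<close>.\<close>

definition outer_left ::
    "('v, 'b, 'r) palg \<Rightarrow> ('v, 'b, 'r) palg2 \<Rightarrow> ('v, 'b, 'r::comm_ring_1) palg2" where
  "outer_left y = lin_ext (\<lambda>(p, q). (y \<cdot> basis p) \<otimes> basis q)"

definition outer_right ::
    "('v, 'b, 'r) palg2 \<Rightarrow> ('v, 'b, 'r) palg \<Rightarrow> ('v, 'b, 'r::comm_ring_1) palg2" where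
  "outer_right t z = lin_ext (\<lambda>(p, q). basis p \<otimes> (basis q \<cdot> z)) t"


section \<open>Double brackets\<close>

type_synonym ('v, 'b, 'r) bracket =
  "('v, 'b, 'r) palg \<times> ('v, 'b, 'r) palg \<Rightarrow> ('v, 'b, 'r) palg2"

text \<open>
  The extensional function space makes the bracket a function on \<open>A \<times> A\<close> proper, so that two
  brackets are equal as soon as they agree on \<open>A \<times> A\<close>.
\<close>

definition double_bracket ::
    "('v, 'b) pre_digraph \<Rightarrow> ('v, 'b, 'r::comm_ring_1) bracket \<Rightarrow> bool" where
  "double_bracket G br \<longleftrightarrow>
     br \<in> path_algebra G \<times> path_algebra G \<rightarrow>\<^sub>E path_algebra2 G \<and>
     (\<forall>x\<in>path_algebra G. linear_on (path_algebra G) (\<lambda>y. br (x, y))) \<and>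
     (\<forall>y\<in>path_algebra G. linear_on (path_algebra G) (\<lambda>x. br (x, y))) \<and>
     (\<forall>x\<in>path_algebra G. \<forall>y\<in>path_algebra G. br (x, y) = - flip (br (y, x))) \<and>
     (\<forall>x\<in>path_algebra G. \<forall>y\<in>path_algebra G. \<forall>z\<in>path_algebra G.
        br (x, y \<cdot> z) = outer_left y (br (x, z)) + outer_right (br (x, y)) z) \<and>
     (\<forall>x\<in>path_algebra G. \<forall>i\<in>verts G. br (x, vertex_elem i) = 0)"

definition bracketL ::
    "('v, 'b, 'r) bracket \<Rightarrow> ('v, 'b, 'r) palg \<Rightarrow> ('v, 'b, 'r) palg2 \<Rightarrow>
     ('v, 'b, 'r::comm_ring_1) palg3" where
  "bracketL br x = lin_ext (\<lambda>(p, q). br (x, basis p) \<otimes> basis q)"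

definition triple_bracket ::
    "('v, 'b, 'r) bracket \<Rightarrow> ('v, 'b, 'r) palg \<Rightarrow> ('v, 'b, 'r) palg \<Rightarrow> ('v, 'b, 'r) palg \<Rightarrow>
     ('v, 'b, 'r::comm_ring_1) palg3" where
  "triple_bracket br x y z =
     bracketL br x (br (y, z)) + rotate3 (bracketL br y (br (z, x))) +
     rotate3 (rotate3 (bracketL br z (br (x, y))))"

definition poisson_double_bracket ::
    "('v, 'b) pre_digraph \<Rightarrow> ('v, 'b, 'r::comm_ring_1) bracket \<Rightarrow> bool" where
  "poisson_double_bracket G br \<longleftrightarrow> double_bracket G br \<and>
     (\<forall>x\<in>path_algebra G. \<forall>y\<in>path_algebra G. \<forall>z\<in>path_algebra G. triple_bracket br x y z = 0)"

definition plus_bracket ::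
    "('v, 'a) pre_digraph \<Rightarrow> ('v, 'a + 'a, 'r::comm_ring_1) bracket \<Rightarrow> bool" where
  "plus_bracket Q br \<longleftrightarrow> double_bracket (double Q) br \<and>
     (\<forall>a\<in>arcs (double Q). \<forall>b\<in>arcs (double Q).
        br (arrow_elem (double Q) a, arrow_elem (double Q) b) =
          scale (of_int (pairing a b))
            ((arrow_elem (double Q) b \<cdot> arrow_elem (double Q) a) \<otimes>
             (arrow_elem (double Q) a \<cdot> arrow_elem (double Q) b)))"


section \<open>The defining formulas on pure tensors\<close>

lemma lookup_scale [simp]: "Poly_Mapping.lookup (scale r x) p = r * Poly_Mapping.lookup x p"
  by (simp add: scale_def Poly_Mapping.map.rep_eq when_def)

lemma module_scale: "module (scale :: 'r::comm_ring_1 \<Rightarrow> ('p \<Rightarrow>\<^sub>0 'r) \<Rightarrow> _)"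
  by unfold_locales (auto intro!: poly_mapping_eqI simp: lookup_add algebra_simps)

lemma keys_scale_subset: "Poly_Mapping.keys (scale r x) \<subseteq> Poly_Mapping.keys x"
  by (auto simp: in_keys_iff)

lemma lin_ext_superset:
  assumes "finite S" "Poly_Mapping.keys x \<subseteq> S"
  shows "lin_ext f x = (\<Sum>p\<in>S. scale (Poly_Mapping.lookup x p) (f p))"
  unfolding lin_ext_def
  by (rule sum.mono_neutral_left)
    (use assms in \<open>auto simp: in_keys_iff module.scale_zero_left[OF module_scale]\<close>)

lemma lin_ext_add: "lin_ext f (x + y) = lin_ext f x + lin_ext f y"
proof -
  let ?S = "Poly_Mapping.keys x \<union> Poly_Mapping.keys y"
  have "Poly_Mapping.keys (x + y) \<subseteq> ?S" by (rule Poly_Mapping.keys_add)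
  then show ?thesis
    by (simp add: lin_ext_superset[of ?S] lookup_add module.scale_left_distrib[OF module_scale]
        sum.distrib)
qed

lemma lin_ext_scale: "lin_ext f (scale r x) = scale r (lin_ext f x)"
  using keys_scale_subset[of r x]
  by (simp add: lin_ext_superset[of "Poly_Mapping.keys x"] module.scale_sum_right[OF module_scale]
      module.scale_scale[OF module_scale])

lemma lin_ext_zero [simp]: "lin_ext f 0 = 0"
  by (simp add: lin_ext_def)

lemma lin_ext_sum: "lin_ext f (\<Sum>i\<in>I. g i) = (\<Sum>i\<in>I. lin_ext f (g i))"
  by (induction I rule: infinite_finite_induct) (simp_all add: lin_ext_add)

lemma lin_ext_basis [simp]: "lin_ext f (basis p) = f p"
  by (simp add: lin_ext_def basis_def module.scale_one[OF module_scale])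

lemma lin_ext_id: "lin_ext basis x = x"
  by (rule poly_mapping_eqI)
    (simp add: lin_ext_def basis_def lookup_sum lookup_single when_def in_keys_iff
      if_distrib[of "(*) _"] sum.delta cong: if_cong)

lemma linear_on_sum:
  assumes f: "linear_on (free_module P) f"
    and g: "\<And>i. i \<in> I \<Longrightarrow> g i \<in> free_module P"
  shows "f (\<Sum>i\<in>I. g i) = (\<Sum>i\<in>I. f (g i))"
proof -
  have z: "(0::'a \<Rightarrow>\<^sub>0 'b) \<in> free_module P" by (simp add: free_module_def)
  have "f (0 + 0) = f 0 + f 0" using f z unfolding linear_on_def by blast
  then have f0: "f 0 = 0" by simp
  have "(\<Sum>i\<in>I. g i) \<in> free_module P \<and> f (\<Sum>i\<in>I. g i) = (\<Sum>i\<in>I. f (g i))"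
    using g
  proof (induction I rule: infinite_finite_induct)
    case (insert i I)
    moreover have "g i + sum g I \<in> free_module P"
      using insert Poly_Mapping.keys_add[of "g i" "sum g I"] by (auto simp: free_module_def)
    ultimately show ?case using f by (simp add: linear_on_def)
  qed (simp_all add: f0 z)
  then show ?thesis by simp
qed

lemma linear_on_eq_lin_ext:
  fixes f :: "('p \<Rightarrow>\<^sub>0 'r::comm_ring_1) \<Rightarrow> ('q \<Rightarrow>\<^sub>0 'r)"
  assumes f: "linear_on (free_module P) f" and x: "x \<in> free_module P"
  shows "f x = lin_ext (\<lambda>p. f (basis p)) x"
proof -
  have b: "(basis p :: 'p \<Rightarrow>\<^sub>0 'r) \<in> free_module P" if "p \<in> Poly_Mapping.keys x" for p
    using that x by (auto simp: free_module_def basis_def)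
  have sb: "scale r (basis p) \<in> free_module P" if "p \<in> Poly_Mapping.keys x" for r :: 'r and p
    using b[OF that] keys_scale_subset[of r "basis p"] unfolding free_module_def by blast
  have "f x = f (\<Sum>p\<in>Poly_Mapping.keys x. scale (Poly_Mapping.lookup x p) (basis p))"
    using lin_ext_id[of x] by (simp add: lin_ext_def)
  also have "\<dots> = (\<Sum>p\<in>Poly_Mapping.keys x. f (scale (Poly_Mapping.lookup x p) (basis p)))"
    by (rule linear_on_sum[OF f sb])
  also have "\<dots> = lin_ext (\<lambda>p. f (basis p)) x"
    unfolding lin_ext_def by (rule sum.cong) (use f b in \<open>auto simp: linear_on_def\<close>)
  finally show ?thesis .
qed

lemma basis_tensor_basis [simp]: "basis p \<otimes> basis q = basis (p, q)"
  by (simp add: tensor_def)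

lemma lin_ext_tensor: "lin_ext f (x \<otimes> y) = lin_ext (\<lambda>p. lin_ext (\<lambda>q. f (p, q)) y) x"
  by (simp add: tensor_def lin_ext_def[of _ x] lin_ext_def[of _ y] lin_ext_sum lin_ext_scale)

lemma lin_ext_swap: "lin_ext (\<lambda>p. lin_ext (f p) y) x = lin_ext (\<lambda>q. lin_ext (\<lambda>p. f p q) x) y"
  unfolding lin_ext_def module.scale_sum_right[OF module_scale] module.scale_scale[OF module_scale]
  by (subst sum.swap) (simp add: mult.commute)

lemma lin_ext_compose: "lin_ext g (lin_ext f x) = lin_ext (\<lambda>p. lin_ext g (f p)) x"
  by (simp add: lin_ext_def[of f] lin_ext_def[of "\<lambda>p. lin_ext g (f p)"] lin_ext_sum lin_ext_scale)

lemma tensor_universal: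
  fixes B :: "('p \<Rightarrow>\<^sub>0 'r::comm_ring_1) \<Rightarrow> ('q \<Rightarrow>\<^sub>0 'r) \<Rightarrow> ('s \<Rightarrow>\<^sub>0 'r)"
  assumes "\<And>x. x \<in> free_module P \<Longrightarrow> linear_on (free_module P') (\<lambda>y. B x y)"
    and "\<And>y. y \<in> free_module P' \<Longrightarrow> linear_on (free_module P) (\<lambda>x. B x y)"
  shows "\<exists>f. linear_on (free_module (P \<times> P')) f \<and>
      (\<forall>x\<in>free_module P. \<forall>y\<in>free_module P'. f (x \<otimes> y) = B x y) \<and>
      (\<forall>g. linear_on (free_module (P \<times> P')) g \<and>
         (\<forall>x\<in>free_module P. \<forall>y\<in>free_module P'. g (x \<otimes> y) = B x y) \<longrightarrow>
         (\<forall>t\<in>free_module (P \<times> P'). g t = f t))"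
proof (intro exI conjI ballI allI impI)
  let ?f = "lin_ext (\<lambda>(p, q). B (basis p) (basis q))"
  show "linear_on (free_module (P \<times> P')) ?f"
    by (simp add: linear_on_def lin_ext_add lin_ext_scale)
  show "?f (x \<otimes> y) = B x y" if "x \<in> free_module P" "y \<in> free_module P'" for x y
  proof -
    have "B x y = lin_ext (\<lambda>p. B (basis p) y) x"
      by (rule linear_on_eq_lin_ext[OF assms(2)[OF that(2)] that(1)])
    also have "\<dots> = lin_ext (\<lambda>p. lin_ext (\<lambda>q. B (basis p) (basis q)) y) x"
    proof -
      have "B (basis p) y = lin_ext (\<lambda>q. B (basis p) (basis q)) y"
        if p: "p \<in> Poly_Mapping.keys x" for p
      proof (rule linear_on_eq_lin_ext[OF assms(1) \<open>y \<in> _\<close>])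
        show "basis p \<in> free_module P"
          using p \<open>x \<in> _\<close> by (auto simp: free_module_def basis_def)
      qed
      then show ?thesis unfolding lin_ext_def[of _ x] by (intro sum.cong) auto
    qed
    finally show ?thesis by (simp add: lin_ext_tensor)
  qed
  show "g t = ?f t"
    if g: "linear_on (free_module (P \<times> P')) g \<and>
         (\<forall>x\<in>free_module P. \<forall>y\<in>free_module P'. g (x \<otimes> y) = B x y)"
      and t: "t \<in> free_module (P \<times> P')" for g t
  proof -
    have "g (basis pq) = (case pq of (p, q) \<Rightarrow> B (basis p) (basis q))"
      if "pq \<in> Poly_Mapping.keys t" for pq
    proof -
      obtain p q where pq: "pq = (p, q)" by force
      have "p \<in> P" "q \<in> P'" using that t pq by (auto simp: free_module_def)
      then have "(basis p :: 'p \<Rightarrow>\<^sub>0 'r) \<in> free_module P" "(basis q :: 'q \<Rightarrow>\<^sub>0 'r) \<in> free_module P'"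
        by (simp_all add: free_module_def basis_def)
      then have "g (basis p \<otimes> basis q) = B (basis p) (basis q)" using g by blast
      then show ?thesis by (simp add: pq)
    qed
    then have "lin_ext (\<lambda>pq. g (basis pq)) t = ?f t"
      unfolding lin_ext_def by (intro sum.cong) auto
    then show ?thesis using linear_on_eq_lin_ext g t by metis
  qed
qed

lemma flip_tensor: "flip (x \<otimes> y) = y \<otimes> x"
  by (simp add: flip_def lin_ext_tensor) (simp add: tensor_def lin_ext_swap[of _ y])

lemma rotate3_tensor: "rotate3 (x \<otimes> y \<otimes> z) = z \<otimes> x \<otimes> y"
proof -
  have "rotate3 (x \<otimes> y \<otimes> z) =
      lin_ext (\<lambda>p. lin_ext (\<lambda>q. lin_ext (\<lambda>r. basis ((r, p), q)) z) y) x"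
    by (simp add: rotate3_def lin_ext_tensor)
  also have "\<dots> = lin_ext (\<lambda>p. lin_ext (\<lambda>r. lin_ext (\<lambda>q. basis ((r, p), q)) y) z) x"
    by (subst (2) lin_ext_swap) simp
  also have "\<dots> = lin_ext (\<lambda>r. lin_ext (\<lambda>p. lin_ext (\<lambda>q. basis ((r, p), q)) y) x) z"
    by (rule lin_ext_swap)
  also have "\<dots> = z \<otimes> x \<otimes> y"
    by (simp add: tensor_def[of "z \<otimes> x"] lin_ext_tensor)
  finally show ?thesis .
qed

lemma tensor_lin_ext_left: "lin_ext f x \<otimes> y = lin_ext (\<lambda>p. f p \<otimes> y) x"
  by (simp add: tensor_def lin_ext_compose)

lemma tensor_lin_ext_right: "x \<otimes> lin_ext f y = lin_ext (\<lambda>q. x \<otimes> f q) y"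
  by (simp add: tensor_def lin_ext_compose) (rule lin_ext_swap)

lemma tensor_basis_right: "lin_ext (\<lambda>q. x \<otimes> basis q) y = x \<otimes> y"
  by (simp add: tensor_lin_ext_right[symmetric] lin_ext_id)

lemma tensor_basis_left: "lin_ext (\<lambda>p. basis p \<otimes> y) x = x \<otimes> y"
  by (simp add: tensor_lin_ext_left[symmetric] lin_ext_id)

lemma mult_basis_right: "lin_ext (\<lambda>p. y \<cdot> basis p) x = y \<cdot> x"
  unfolding mult_def by (simp add: lin_ext_swap[of _ x y])

lemma mult_basis_left: "lin_ext (\<lambda>p. basis p \<cdot> y) x = x \<cdot> y"
  unfolding mult_def by simp

lemma outer_left_tensor: "outer_left y (u \<otimes> v) = (y \<cdot> u) \<otimes> v"
  unfolding outer_left_def lin_ext_tensor prod.case tensor_basis_right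
  by (simp add: tensor_lin_ext_left[symmetric] mult_basis_right)

lemma outer_right_tensor: "outer_right (u \<otimes> v) z = u \<otimes> (v \<cdot> z)"
  unfolding outer_right_def lin_ext_tensor prod.case tensor_lin_ext_right[symmetric]
    mult_basis_left tensor_basis_left ..

lemma bracketL_tensor:
  assumes br: "double_bracket G br"
    and x: "x \<in> path_algebra G" and u: "u \<in> path_algebra G"
  shows "bracketL br x (u \<otimes> v) = br (x, u) \<otimes> v"
proof -
  have "linear_on (free_module (paths G)) (\<lambda>y. br (x, y))"
    using br x by (simp add: double_bracket_def path_algebra_def)
  then have "br (x, u) = lin_ext (\<lambda>p. br (x, basis p)) u"
    by (rule linear_on_eq_lin_ext) (use u in \<open>simp add: path_algebra_def\<close>)
  then show ?thesis
    unfolding bracketL_def lin_ext_tensor prod.case tensor_basis_right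
    by (simp add: tensor_lin_ext_left)
qed

end

theory Submission
  imports Defs
begin

text \<open>
  Write \<open>p\<^sub>\<le>\<^sub>i\<close> and \<open>p\<^sub>\<ge>\<^sub>i\<close> for the initial and final segments of a path \<open>p\<close> that both contain its
  \<open>i\<close>-th arrow \<open>p\<^sub>i\<close>. The derivation rules force the bracket of two paths to be
  \<open>\<Sum> \<langle>p\<^sub>i, q\<^sub>j\<rangle> q\<^sub>\<le>\<^sub>j p\<^sub>\<ge>\<^sub>i \<otimes> p\<^sub>\<le>\<^sub>i q\<^sub>\<ge>\<^sub>j\<close>, the sum being over all \<open>i\<close> and \<open>j\<close>. For paths \<open>p\<close>, \<open>q\<close>, \<open>r\<close>,
  the arrow of \<open>q\<^sub>\<ge>\<^sub>j\<close> or \<open>r\<^sub>\<le>\<^sub>k\<close> that is paired with \<open>p\<^sub>i\<close> in \<open>{{p, {{q, r}}}}\<^sub>L\<close> lies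
  in \<open>r\<close> or in \<open>q\<close>. If \<open>S(p, q, r)\<close> is the sum of the terms of the first kind, antisymmetry of the
  pairing makes the sum of the second kind \<open>- \<tau>\<^sup>2 S(r, p, q)\<close>, so the triple bracket telescopes to zero.
\<close>

section \<open>Linear extensions\<close>

lemma scale_add: "scale r (x + y) = scale r x + scale r y"
  by (rule module.scale_right_distrib[OF module_scale])

lemma scale_minus: "scale r (- x) = - scale r x"
  by (rule module.scale_minus_right[OF module_scale])

lemma scale_sum: "scale r (sum f I) = (\<Sum>i\<in>I. scale r (f i))"
  by (rule module.scale_sum_right[OF module_scale])

lemma scale_scale: "scale r (scale s x) = scale (r * s) x"
  by (rule module.scale_scale[OF module_scale])

lemma scale_zero_right [simp]: "scale r 0 = 0"
  by (rule module.scale_zero_right[OF module_scale])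

lemma scale_zero_left [simp]: "scale 0 x = 0"
  by (rule module.scale_zero_left[OF module_scale])

lemma lin_ext_fun_add: "lin_ext (\<lambda>p. f p + g p) x = lin_ext f x + lin_ext g x"
  by (simp add: lin_ext_def scale_add sum.distrib)

lemma lin_ext_fun_scale: "lin_ext (\<lambda>p. scale r (f p)) x = scale r (lin_ext f x)"
  by (simp add: lin_ext_def scale_sum scale_scale mult.commute)

lemma lin_ext_fun_zero [simp]: "lin_ext (\<lambda>p. 0) x = 0"
  by (simp add: lin_ext_def)

lemma lin_ext_minus: "lin_ext f (- x) = - lin_ext f x"
  using lin_ext_add[of f x "- x"] by (simp add: minus_unique)

lemma lin_ext_diff: "lin_ext f (x - y) = lin_ext f x - lin_ext f y"
  using lin_ext_add[of f x "- y"] by (simp add: lin_ext_minus)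

lemma lin_ext_cong:
  "(\<And>p. p \<in> Poly_Mapping.keys x \<Longrightarrow> f p = g p) \<Longrightarrow> lin_ext f x = lin_ext g x"
  by (simp add: lin_ext_def)

text \<open>Every element is a finite linear combination of basis vectors. Multilinear identities
  are thereby reduced to basis vectors, one argument at a time.\<close>

lemma basis_induct [case_names basis add scale]:
  assumes basis: "\<And>p. P (basis p)"
    and add: "\<And>x y. P x \<Longrightarrow> P y \<Longrightarrow> P (x + y)"
    and scale: "\<And>r x. P x \<Longrightarrow> P (scale r x)"
  shows "P x"
proof -
  \<comment> \<open>Zero is 0 times any basis vector; \<open>undefined\<close> merely supplies an
    index.\<close>
  have zero: "P 0"
    using scale[OF basis, of 0 undefined] by simp
  have "P (\<Sum>p\<in>I. scale (Poly_Mapping.lookup x p) (basis p))" for I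
    by (induction I rule: infinite_finite_induct) (simp_all add: zero basis add scale)
  then have "P (lin_ext basis x)"
    by (simp add: lin_ext_def)
  then show ?thesis
    by (simp add: lin_ext_id)
qed

lemma free_module_zero: "0 \<in> free_module P"
  by (simp add: free_module_def)

lemma free_module_basis: "p \<in> P \<Longrightarrow> basis p \<in> free_module P"
  by (simp add: free_module_def basis_def)

lemma free_module_scale: "x \<in> free_module P \<Longrightarrow> scale r x \<in> free_module P"
  using keys_scale_subset[of r x] by (auto simp: free_module_def)

lemma free_module_sum:
  "(\<And>i. i \<in> I \<Longrightarrow> f i \<in> free_module P) \<Longrightarrow> sum f I \<in> free_module P"
proof (induction I rule: infinite_finite_induct)
  case (insert i I)
  then show ?case
    using Poly_Mapping.keys_add[of "f i" "sum f I"] by (auto simp: free_module_def)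
qed (simp_all add: free_module_zero)

lemma free_module_lin_ext:
  assumes "x \<in> free_module P" "\<And>p. p \<in> P \<Longrightarrow> f p \<in> free_module P'"
  shows "lin_ext f x \<in> free_module P'"
  using assms unfolding lin_ext_def
  by (intro free_module_sum free_module_scale) (auto simp: free_module_def)

section \<open>Bilinearity of tensors, products and outer actions\<close>

lemma tensor_add_left: "(x + y) \<otimes> z = x \<otimes> z + y \<otimes> z"
  by (simp add: tensor_def lin_ext_add)

lemma tensor_add_right: "x \<otimes> (y + z) = x \<otimes> y + x \<otimes> z"
  by (simp add: tensor_def lin_ext_add lin_ext_fun_add)

lemma tensor_scale_left: "scale r x \<otimes> y = scale r (x \<otimes> y)"
  by (simp add: tensor_def lin_ext_scale)

lemma tensor_scale_right: "x \<otimes> scale r y = scale r (x \<otimes> y)"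
  by (simp add: tensor_def lin_ext_scale lin_ext_fun_scale)

lemma tensor_zero_left [simp]: "0 \<otimes> y = 0"
  by (simp add: tensor_def)

lemma tensor_zero_right [simp]: "x \<otimes> 0 = 0"
  by (simp add: tensor_def)

lemma tensor_sum_left: "sum f I \<otimes> y = (\<Sum>i\<in>I. f i \<otimes> y)"
  by (simp add: tensor_def lin_ext_sum)

lemma mult_add_left: "(x + y) \<cdot> z = x \<cdot> z + y \<cdot> z"
  by (simp add: mult_def lin_ext_add)

lemma mult_add_right: "x \<cdot> (y + z) = x \<cdot> y + x \<cdot> z"
  by (simp add: mult_def lin_ext_add lin_ext_fun_add)

lemma mult_scale_left: "scale r x \<cdot> y = scale r (x \<cdot> y)"
  by (simp add: mult_def lin_ext_scale)

lemma mult_scale_right: "x \<cdot> scale r y = scale r (x \<cdot> y)"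
  by (simp add: mult_def lin_ext_scale lin_ext_fun_scale)

lemma mult_basis [simp]: "basis p \<cdot> basis q = path_mult p q"
  by (simp add: mult_def)

lemma outer_left_add: "outer_left (x + y) t = outer_left x t + outer_left y t"
  by (simp add: outer_left_def mult_add_left tensor_add_left split_def lin_ext_fun_add)

lemma outer_left_scale: "outer_left (scale r x) t = scale r (outer_left x t)"
  by (simp add: outer_left_def mult_scale_left tensor_scale_left split_def lin_ext_fun_scale)

lemma outer_right_add: "outer_right t (x + y) = outer_right t x + outer_right t y"
  by (simp add: outer_right_def mult_add_right tensor_add_right split_def lin_ext_fun_add)

lemma outer_right_scale: "outer_right t (scale r x) = scale r (outer_right t x)"
  by (simp add: outer_right_def mult_scale_right tensor_scale_right split_def lin_ext_fun_scale)

lemma outer_left_arg_add: "outer_left x (t + t') = outer_left x t + outer_left x t'"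
  by (simp add: outer_left_def lin_ext_add)

lemma outer_left_arg_scale: "outer_left x (scale r t) = scale r (outer_left x t)"
  by (simp add: outer_left_def lin_ext_scale)

lemma outer_right_arg_add: "outer_right (t + t') x = outer_right t x + outer_right t' x"
  by (simp add: outer_right_def lin_ext_add)

lemma outer_right_arg_scale: "outer_right (scale r t) x = scale r (outer_right t x)"
  by (simp add: outer_right_def lin_ext_scale)


section \<open>The bracket of two paths\<close>

lemma pairing_antisym: "pairing b a = - pairing a b"
  by (cases a; cases b) auto

text \<open>A nonzero pairing means that the arrows are opposites, so each starts where the other
  ends. This makes the spliced words of the bracket composable.\<close>

lemma head_double_eq_tail:
  assumes "pairing a b \<noteq> 0"
  shows "head (double Q) b = tail (double Q) a" "head (double Q) a = tail (double Q) b"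
  using assms by (cases a; cases b; auto simp: double_def split: if_splits)+

text \<open>
  Since the formula makes sense for words that are not paths, no composability conditions are
  needed until closedness.
\<close>

fun path_bracket ::
    "('v, 'a + 'a) qpath \<Rightarrow> ('v, 'a + 'a) qpath \<Rightarrow> ('v, 'a + 'a, 'r::comm_ring_1) palg2" where
  "path_bracket (u, p, v) (u', q, v') =
     (\<Sum>i<length p. \<Sum>j<length q. scale (of_int (pairing (p ! i) (q ! j)))
        (basis ((u', take (Suc j) q @ drop i p, v), (u, take (Suc i) p @ drop j q, v'))))"

text \<open>The bilinear extension is total on formal words, so its identities can be checked on
  arbitrary basis words. The restriction to the path algebra is made in
  \<open>quiver_bracket\<close>.\<close>

definition word_bracket ::
    "('v, 'a + 'a, 'r) palg \<Rightarrow> ('v, 'a + 'a, 'r) palg \<Rightarrow> ('v, 'a + 'a, 'r::comm_ring_1) palg2" where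
  "word_bracket x y = lin_ext (\<lambda>p. lin_ext (path_bracket p) y) x"

lemma word_bracket_basis [simp]: "word_bracket (basis p) (basis q) = path_bracket p q"
  by (simp add: word_bracket_def)

lemma word_bracket_add_left: "word_bracket (x + y) z = word_bracket x z + word_bracket y z"
  by (simp add: word_bracket_def lin_ext_add)

lemma word_bracket_add_right: "word_bracket x (y + z) = word_bracket x y + word_bracket x z"
  by (simp add: word_bracket_def lin_ext_add lin_ext_fun_add)

lemma word_bracket_scale_left: "word_bracket (scale r x) y = scale r (word_bracket x y)"
  by (simp add: word_bracket_def lin_ext_scale)

lemma word_bracket_scale_right: "word_bracket x (scale r y) = scale r (word_bracket x y)"
  by (simp add: word_bracket_def lin_ext_scale lin_ext_fun_scale)

text \<open>Exchanging the two paths swaps the tensor factors of each term and negates its pairing;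
  only the order of summation differs.\<close>

lemma path_bracket_flip: "path_bracket p q = - flip (path_bracket q p)"
proof -
  obtain u p' v u' q' v' where [simp]: "p = (u, p', v)" "q = (u', q', v')"
    by (metis prod_cases3)
  show ?thesis
    by (simp add: flip_def lin_ext_sum lin_ext_scale)
      (subst (2) sum.swap, simp add: sum_negf[symmetric] pairing_antisym[of "p' ! _"]
        module.scale_minus_left[OF module_scale])
qed

lemma word_bracket_flip: "word_bracket x y = - flip (word_bracket y x)"
proof -
  have "- flip (word_bracket y x) = lin_ext (\<lambda>q. lin_ext (\<lambda>p. - flip (path_bracket q p)) x) y"
    by (simp add: word_bracket_def flip_def lin_ext_compose lin_ext_def[of "\<lambda>p. - _ p"]
        lin_ext_def[of "\<lambda>p. lin_ext _ (_ p)"] scale_minus sum_negf)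
      (simp add: lin_ext_def scale_minus sum_negf)
  also have "\<dots> = word_bracket x y"
    by (simp add: path_bracket_flip[symmetric] word_bracket_def lin_ext_swap[of _ y])
  finally show ?thesis ..
qed

section \<open>The derivation rule\<close>

lemma sum_lessThan_add: "sum f {..<m + n} = sum f {..<m} + (\<Sum>j<n. f (m + j))"
  for f :: "nat \<Rightarrow> 'a::comm_monoid_add"
  by (induction n) (simp_all add: add.assoc)

text \<open>The arrow paired with one of \<open>p\<close> lies in \<open>q\<close> or in
  \<open>q'\<close>; position \<open>j\<close> of \<open>q'\<close> is position
  \<open>length q + j\<close> of the whole word.\<close>

lemma path_bracket_append:
  "path_bracket (u, p, v) (u', q @ q', v') =
     (\<Sum>i<length p. \<Sum>j<length q. scale (of_int (pairing (p ! i) (q ! j)))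
        (basis ((u', take (Suc j) q @ drop i p, v), (u, take (Suc i) p @ drop j q @ q', v')))) +
     (\<Sum>i<length p. \<Sum>j<length q'. scale (of_int (pairing (p ! i) (q' ! j)))
        (basis ((u', q @ take (Suc j) q' @ drop i p, v), (u, take (Suc i) p @ drop j q', v'))))"
  by (simp add: sum_lessThan_add sum.distrib nth_append Suc_diff_le)

text \<open>Left multiplication by \<open>q\<close> prolongs the first tensor factor at its start,
  right multiplication by \<open>q'\<close> the second at its end. This yields the two sums of
  \<open>path_bracket_append\<close>.\<close>

lemma word_bracket_path_mult:
  "word_bracket (basis p) (path_mult q q') =
     outer_left (basis q) (path_bracket p q') + outer_right (path_bracket p q) (basis q')"
proof -
  obtain u p1 v u' q1 w w' q2 v'
    where [simp]: "p = (u, p1, v)" "q = (u', q1, w)" "q' = (w', q2, v')"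
    by (metis prod_cases3)
  have l: "outer_left (basis q) (path_bracket p q') =
      (if w = w' then \<Sum>i<length p1. \<Sum>j<length q2. scale (of_int (pairing (p1 ! i) (q2 ! j)))
        (basis ((u', q1 @ take (Suc j) q2 @ drop i p1, v), (u, take (Suc i) p1 @ drop j q2, v')))
       else 0)"
    by (simp add: outer_left_def lin_ext_sum lin_ext_scale)
  have r: "outer_right (path_bracket p q) (basis q') =
      (if w = w' then \<Sum>i<length p1. \<Sum>j<length q1. scale (of_int (pairing (p1 ! i) (q1 ! j)))
        (basis ((u', take (Suc j) q1 @ drop i p1, v), (u, take (Suc i) p1 @ drop j q1 @ q2, v')))
       else 0)"
    by (simp add: outer_right_def lin_ext_sum lin_ext_scale)
  show ?thesis
  proof (cases "w = w'")
    case True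
    then have "word_bracket (basis p) (path_mult q q') = path_bracket (u, p1, v) (u', q1 @ q2, v')"
      by simp
    then show ?thesis
      unfolding l r path_bracket_append using True by (simp add: add.commute)
  next
    \<comment> \<open>The first factors of \<open>path_bracket p q'\<close> start at
      \<open>w'\<close> and the second factors of \<open>path_bracket p q\<close> end at
      \<open>w\<close>, so both outer products vanish along with
      \<open>path_mult q q'\<close>.\<close>
    case False
    then show ?thesis
      unfolding l r by (simp add: word_bracket_def)
  qed
qed

lemma word_bracket_mult:
  "word_bracket x (y \<cdot> z) = outer_left y (word_bracket x z) + outer_right (word_bracket x y) z"
proof (induction x rule: basis_induct)
  case (basis p)
  show ?case
  proof (induction y rule: basis_induct)
    case (basis q)
    show ?case
    proof (induction z rule: basis_induct)
      case (basis q')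
      show ?case by (simp add: word_bracket_path_mult)
    qed (simp_all add: mult_add_right mult_scale_right word_bracket_add_right
        word_bracket_scale_right outer_left_arg_add outer_left_arg_scale outer_right_add
        outer_right_scale scale_add)
  qed (simp_all add: mult_add_left mult_scale_left word_bracket_add_right
      word_bracket_scale_right outer_left_add outer_left_scale outer_right_arg_add
      outer_right_arg_scale scale_add)
qed (simp_all add: word_bracket_add_left word_bracket_scale_left outer_left_arg_add
    outer_left_arg_scale outer_right_arg_add outer_right_arg_scale scale_add)


section \<open>Existence and uniqueness\<close>

lemma wf_digraph_double: "wf_digraph Q \<Longrightarrow> wf_digraph (double Q)"
  by (auto simp: wf_digraph_def double_def)

text \<open>The walk is cut just after its \<open>i\<close>-th arrow; \<open>awalk_drop_nth\<close>
  cuts it just before, so both segments keep that arrow.\<close>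

lemma (in wf_digraph) awalk_take_nth:
  assumes "awalk u p v" "i < length p"
  shows "awalk u (take (Suc i) p) (head G (p ! i))"
proof -
  have "take (Suc i) p = take i p @ [p ! i]"
    using assms(2) by (simp add: take_Suc_conv_app_nth)
  moreover have "awalk u (take i p @ p ! i # drop (Suc i) p) v"
    using assms by (simp add: id_take_nth_drop[symmetric])
  ultimately show ?thesis
    by (auto simp: awalk_Cons_iff awalk_Nil_iff)
qed

lemma (in wf_digraph) awalk_drop_nth:
  assumes "awalk u p v" "i < length p"
  shows "awalk (tail G (p ! i)) (drop i p) v"
proof -
  have "drop i p = p ! i # drop (Suc i) p"
    using assms(2) by (simp add: Cons_nth_drop_Suc)
  moreover have "awalk u (take i p @ p ! i # drop (Suc i) p) v"
    using assms by (simp add: id_take_nth_drop[symmetric])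
  ultimately show ?thesis
    by (auto simp: awalk_Cons_iff)
qed

lemma path_bracket_closed:
  assumes Q: "wf_digraph Q" and p: "p \<in> paths (double Q)" and q: "q \<in> paths (double Q)"
  shows "path_bracket p q \<in> path_algebra2 (double Q)"
proof -
  interpret wf_digraph "double Q"
    using Q by (rule wf_digraph_double)
  obtain u p' v u' q' v' where pq: "p = (u, p', v)" "q = (u', q', v')"
    by (metis prod_cases3)
  have w: "awalk u p' v" "awalk u' q' v'"
    using p q by (simp_all add: pq paths_def)
  have "scale (of_int (pairing (p' ! i) (q' ! j)))
      (basis ((u', take (Suc j) q' @ drop i p', v), (u, take (Suc i) p' @ drop j q', v')))
      \<in> free_module (paths (double Q) \<times> paths (double Q))"
    if i: "i < length p'" and j: "j < length q'" for i j
  \<comment> \<open>If the pairing is zero, the spliced words may fail to be paths, but their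
    coefficient vanishes. Otherwise the segments meet at a common vertex.\<close>
  proof (cases "pairing (p' ! i) (q' ! j) = 0")
    case True
    then show ?thesis by (simp add: free_module_zero)
  next
    case False
    note e = head_double_eq_tail[OF False, of Q]
    have "awalk u' (take (Suc j) q' @ drop i p') v"
      using awalk_take_nth[OF w(2) j] awalk_drop_nth[OF w(1) i] e by (metis awalk_appendI)
    moreover have "awalk u (take (Suc i) p' @ drop j q') v'"
      using awalk_take_nth[OF w(1) i] awalk_drop_nth[OF w(2) j] e by (metis awalk_appendI)
    ultimately show ?thesis
      by (intro free_module_scale free_module_basis) (simp add: paths_def)
  qed
  then show ?thesis
    by (auto simp: pq path_algebra2_def intro!: free_module_sum)
qed

lemma word_bracket_closed:
  assumes "wf_digraph Q" "x \<in> path_algebra (double Q)" "y \<in> path_algebra (double Q)"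
  shows "word_bracket x y \<in> path_algebra2 (double Q)"
  using assms path_bracket_closed[OF assms(1)]
  by (auto simp: word_bracket_def path_algebra_def path_algebra2_def intro!: free_module_lin_ext)

text \<open>The restricted abstraction gives the extensionality that \<open>double_bracket\<close>
  demands.\<close>

definition quiver_bracket :: "('v, 'a) pre_digraph \<Rightarrow> ('v, 'a + 'a, 'r::comm_ring_1) bracket" where
  "quiver_bracket Q = (\<lambda>(x, y)\<in>path_algebra (double Q) \<times> path_algebra (double Q). word_bracket x y)"

lemma basis_mem_path_algebra: "p \<in> paths G \<Longrightarrow> basis p \<in> path_algebra G"
  by (simp add: path_algebra_def free_module_basis)

lemma (in wf_digraph) vertex_elem_mem: "i \<in> verts G \<Longrightarrow> vertex_elem i \<in> path_algebra G"
  by (simp add: vertex_elem_def basis_mem_path_algebra paths_def awalk_Nil_iff)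

lemma (in wf_digraph) arrow_elem_mem: "a \<in> arcs G \<Longrightarrow> arrow_elem G a \<in> path_algebra G"
  by (simp add: arrow_elem_def basis_mem_path_algebra paths_def arc_implies_awalk)

lemma (in wf_digraph) path_algebra_mult:
  assumes "x \<in> path_algebra G" "y \<in> path_algebra G"
  shows "x \<cdot> y \<in> path_algebra G"
proof -
  have closed: "path_mult p q \<in> free_module (paths G)" if "p \<in> paths G" "q \<in> paths G" for p q
    using that
    by (cases p; cases q) (auto simp: paths_def free_module_zero intro!: free_module_basis)
  then show ?thesis
    using assms
    by (auto simp: mult_def path_algebra_def simp del: path_mult.simps
        intro!: free_module_lin_ext closed)
qed

lemma path_algebra_add:
  "x \<in> path_algebra G \<Longrightarrow> y \<in> path_algebra G \<Longrightarrow> x + y \<in> path_algebra G"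
  using Poly_Mapping.keys_add[of x y] by (auto simp: path_algebra_def free_module_def)

lemma path_algebra_scale: "x \<in> path_algebra G \<Longrightarrow> scale r x \<in> path_algebra G"
  by (simp add: path_algebra_def free_module_scale)

text \<open>For two single arrows the double sum has one term. If the pairing is nonzero, both
  products on the right are composable; if it is zero, both sides vanish.\<close>

lemma word_bracket_arrow_elem:
  "word_bracket (arrow_elem (double Q) a) (arrow_elem (double Q) b) =
     scale (of_int (pairing a b))
       ((arrow_elem (double Q) b \<cdot> arrow_elem (double Q) a) \<otimes>
        (arrow_elem (double Q) a \<cdot> arrow_elem (double Q) b))"
  using head_double_eq_tail[of a b Q] by (cases "pairing a b = 0") (auto simp: arrow_elem_def)

lemma plus_bracket_quiver_bracket:
  fixes Q :: "('v, 'a) pre_digraph"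
  assumes Q: "wf_digraph Q"
  shows "plus_bracket Q (quiver_bracket Q :: ('v, 'a + 'a, 'r::comm_ring_1) bracket)"
proof -
  let ?A = "path_algebra (double Q) :: ('v, 'a + 'a, 'r) palg set"
  interpret wf_digraph "double Q"
    using Q by (rule wf_digraph_double)
  have eq: "quiver_bracket Q (x, y) = word_bracket x y" if "x \<in> ?A" "y \<in> ?A" for x y
    using that by (simp add: quiver_bracket_def)
  have "double_bracket (double Q) (quiver_bracket Q :: ('v, 'a + 'a, 'r) bracket)"
    unfolding double_bracket_def
  proof (intro conjI ballI)
    show "quiver_bracket Q \<in> ?A \<times> ?A \<rightarrow>\<^sub>E path_algebra2 (double Q)"
      using word_bracket_closed[OF Q] by (auto simp: quiver_bracket_def)
  next
    fix x :: "('v, 'a + 'a, 'r) palg" assume "x \<in> ?A"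
    then show "linear_on ?A (\<lambda>y. quiver_bracket Q (x, y))"
      by (simp add: linear_on_def eq path_algebra_add path_algebra_scale
          word_bracket_add_right word_bracket_scale_right)
  next
    fix y :: "('v, 'a + 'a, 'r) palg" assume "y \<in> ?A"
    then show "linear_on ?A (\<lambda>x. quiver_bracket Q (x, y))"
      by (simp add: linear_on_def eq path_algebra_add path_algebra_scale
          word_bracket_add_left word_bracket_scale_left)
  next
    fix x y :: "('v, 'a + 'a, 'r) palg" assume "x \<in> ?A" "y \<in> ?A"
    then show "quiver_bracket Q (x, y) = - flip (quiver_bracket Q (y, x))"
      by (simp add: eq word_bracket_flip[of x])
  next
    fix x y z :: "('v, 'a + 'a, 'r) palg" assume "x \<in> ?A" "y \<in> ?A" "z \<in> ?A"
    then show "quiver_bracket Q (x, y \<cdot> z) =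
        outer_left y (quiver_bracket Q (x, z)) + outer_right (quiver_bracket Q (x, y)) z"
      by (simp add: eq path_algebra_mult word_bracket_mult)
  next
    fix x :: "('v, 'a + 'a, 'r) palg" and i assume "x \<in> ?A" "i \<in> verts (double Q)"
    \<comment> \<open>A constant path has no arrows, so the inner sum is empty.\<close>
    moreover have "(path_bracket p (i, [], i) :: ('v, 'a + 'a, 'r) palg2) = 0" for p :: "('v, 'a + 'a) qpath"
      by (cases p) simp
    ultimately show "quiver_bracket Q (x, vertex_elem i) = 0"
      by (simp add: eq vertex_elem_mem) (simp add: vertex_elem_def word_bracket_def)
  qed
  then show ?thesis
    by (simp add: plus_bracket_def eq arrow_elem_mem word_bracket_arrow_elem)
qed

section \<open>Uniqueness from the values on arrows\<close>

lemma double_bracketD: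
  assumes "double_bracket G br"
  shows double_bracket_closed: "br \<in> path_algebra G \<times> path_algebra G \<rightarrow>\<^sub>E path_algebra2 G"
    and double_bracket_linear_right:
      "x \<in> path_algebra G \<Longrightarrow> linear_on (path_algebra G) (\<lambda>y. br (x, y))"
    and double_bracket_flip:
      "x \<in> path_algebra G \<Longrightarrow> y \<in> path_algebra G \<Longrightarrow> br (x, y) = - flip (br (y, x))"
    and double_bracket_mult:
      "x \<in> path_algebra G \<Longrightarrow> y \<in> path_algebra G \<Longrightarrow> z \<in> path_algebra G \<Longrightarrow>
        br (x, y \<cdot> z) = outer_left y (br (x, z)) + outer_right (br (x, y)) z"
    and double_bracket_vertex_elem:
      "x \<in> path_algebra G \<Longrightarrow> i \<in> verts G \<Longrightarrow> br (x, vertex_elem i) = 0"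
  using assms unfolding double_bracket_def by blast+

text \<open>For fixed \<open>x\<close> both brackets are derivations in the second argument that
  kill the \<open>vertex_elem\<close>s. Every path is such an idempotent or a product of arrows, so
  agreement spreads to all paths and then by linearity.\<close>

lemma (in wf_digraph) double_bracket_eq_on_arrows:
  fixes br br' :: "('a, 'b, 'r::comm_ring_1) bracket"
  assumes br: "double_bracket G br" and br': "double_bracket G br'" and x: "x \<in> path_algebra G"
    and arrows: "\<And>a. a \<in> arcs G \<Longrightarrow> br (x, arrow_elem G a) = br' (x, arrow_elem G a)"
    and y: "y \<in> path_algebra G"
  shows "br (x, y) = br' (x, y)"
proof -
  have walk: "br (x, basis (u, p, v)) = br' (x, basis (u, p, v))" if "awalk u p v" for u p v
    using that
  proof (induction p arbitrary: u)
    case Nil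
    then have "(basis (u, [], v) :: ('a, 'b, 'r) palg) = vertex_elem u" "u \<in> verts G"
      by (auto simp: awalk_Nil_iff vertex_elem_def)
    then show ?case
      using x by (simp add: double_bracket_vertex_elem[OF br] double_bracket_vertex_elem[OF br'])
  next
    case (Cons a p)
    then have a: "a \<in> arcs G" "u = tail G a" and p: "awalk (head G a) p v"
      by (simp_all add: awalk_Cons_iff)
    \<comment> \<open>Splitting off the first arrow lets the derivation rule reduce to the shorter
      walk.\<close>
    have "(basis (u, a # p, v) :: ('a, 'b, 'r) palg) = arrow_elem G a \<cdot> basis (head G a, p, v)"
      by (simp add: a arrow_elem_def)
    moreover have "(basis (head G a, p, v) :: ('a, 'b, 'r) palg) \<in> path_algebra G"
      using p by (simp add: basis_mem_path_algebra paths_def)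
    ultimately show ?case
      using arrows[OF a(1)] Cons.IH[OF p]
      by (simp add: x a(1) arrow_elem_mem double_bracket_mult[OF br] double_bracket_mult[OF br'])
  qed
  have "br (x, y) = lin_ext (\<lambda>p. br (x, basis p)) y"
    using double_bracket_linear_right[OF br x] y unfolding path_algebra_def
    by (rule linear_on_eq_lin_ext)
  also have "\<dots> = lin_ext (\<lambda>p. br' (x, basis p)) y"
  proof (rule lin_ext_cong)
    fix p assume "p \<in> Poly_Mapping.keys y"
    then have "p \<in> paths G"
      using y by (auto simp: path_algebra_def free_module_def)
    then show "br (x, basis p) = br' (x, basis p)"
      using walk by (auto simp: paths_def)
  qed
  also have "\<dots> = br' (x, y)"
    using double_bracket_linear_right[OF br' x] y unfolding path_algebra_def
    by (rule linear_on_eq_lin_ext[symmetric])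
  finally show ?thesis .
qed

text \<open>The previous extension argument is applied twice: first with an arrow as the fixed
  argument, then, after antisymmetry has swapped the arguments, with an arbitrary
  \<open>x\<close>.\<close>

lemma (in wf_digraph) double_bracket_eqI:
  assumes br: "double_bracket G br" and br': "double_bracket G br'"
    and arrows: "\<And>a b. a \<in> arcs G \<Longrightarrow> b \<in> arcs G \<Longrightarrow>
      br (arrow_elem G a, arrow_elem G b) = br' (arrow_elem G a, arrow_elem G b)"
  shows "br = br'"
proof -
  have "br (x, y) = br' (x, y)" if x: "x \<in> path_algebra G" and y: "y \<in> path_algebra G" for x y
    using br br' x _ y
  proof (rule double_bracket_eq_on_arrows)
    fix b assume b: "b \<in> arcs G"
    have "br (arrow_elem G b, x) = br' (arrow_elem G b, x)"
      using br br' arrow_elem_mem[OF b] arrows[OF b] x by (rule double_bracket_eq_on_arrows)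
    then show "br (x, arrow_elem G b) = br' (x, arrow_elem G b)"
      by (simp only: double_bracket_flip[OF _ x arrow_elem_mem[OF b]] br br')
  qed
  then show ?thesis
    \<comment> \<open>Off the domain both brackets are \<open>undefined\<close>, so agreement on it
      gives equality of functions.\<close>
    by (intro PiE_ext[OF double_bracket_closed[OF br] double_bracket_closed[OF br']]) auto
qed

lemma plus_bracket_unique:
  assumes "wf_digraph Q" "plus_bracket Q br" "plus_bracket Q br'"
  shows "br = br'"
  using assms
  by (intro wf_digraph.double_bracket_eqI[OF wf_digraph_double[OF assms(1)]])
    (simp_all add: plus_bracket_def)


section \<open>The Poisson property\<close>

lemma rotate3_basis [simp]: "rotate3 (basis ((p, q), r)) = basis ((r, p), q)"
  by (simp add: rotate3_def)

lemma rotate3_add: "rotate3 (s + t) = rotate3 s + rotate3 t"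
  by (simp add: rotate3_def lin_ext_add)

lemma rotate3_minus: "rotate3 (- t) = - rotate3 t"
  by (simp add: rotate3_def lin_ext_minus)

lemma rotate3_diff: "rotate3 (s - t) = rotate3 s - rotate3 t"
  by (simp add: rotate3_def lin_ext_diff)

lemma rotate3_scale: "rotate3 (scale r t) = scale r (rotate3 t)"
  by (simp add: rotate3_def lin_ext_scale)

lemma rotate3_sum: "rotate3 (sum f I) = (\<Sum>i\<in>I. rotate3 (f i))"
  by (simp add: rotate3_def lin_ext_sum)

lemma rotate3_cube [simp]: "rotate3 (rotate3 (rotate3 t)) = t"
proof (induction t rule: basis_induct)
  case (basis p)
  obtain a b c where "p = ((a, b), c)" by (metis surj_pair)
  then show ?case by simp
qed (simp_all add: rotate3_add rotate3_scale)

text \<open>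
  The terms \<open>S(x, y, z)\<close> of the iterated bracket in which the arrow of \<open>x\<close> meets an arrow of \<open>z\<close>.
\<close>

fun left_part ::
    "('v, 'a + 'a) qpath \<Rightarrow> ('v, 'a + 'a) qpath \<Rightarrow> ('v, 'a + 'a) qpath \<Rightarrow>
     ('v, 'a + 'a, 'r::comm_ring_1) palg3" where
  "left_part (u, x, u') (v, y, v') (w, z, w') =
     (\<Sum>i<length x. \<Sum>j<length y. \<Sum>k<length z. \<Sum>l<Suc k.
        scale (of_int (pairing (y ! j) (z ! k) * pairing (x ! i) (z ! l)))
          (basis (((w, take (Suc l) z @ drop i x, u'),
                   (u, take (Suc i) x @ drop l (take (Suc k) z) @ drop j y, v')),
                  (v, take (Suc j) y @ drop k z, w'))))"

text \<open>Substituting \<open>k = j + n\<close> turns an offset counted from position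
  \<open>j\<close> into an absolute position, as \<open>left_part\<close> uses it.\<close>

lemma sum_triangle:
  "(\<Sum>j<m. \<Sum>n<m - j. f j n) = (\<Sum>k<m. \<Sum>j<Suc k. f j (k - j))"
  for f :: "nat \<Rightarrow> nat \<Rightarrow> 'b::comm_monoid_add"
  unfolding sum.Sigma[OF finite_lessThan ballI[OF finite_lessThan]]
  by (rule sum.reindex_bij_witness[where i = "\<lambda>(k, j). (j, k - j)" and j = "\<lambda>(j, n). (j + n, j)"])
    auto

text \<open>The outer bracket acts on the factor \<open>take (Suc k) z @ drop j y\<close>. Its
  arrows are those of \<open>z\<close> at positions up to and including \<open>k\<close>, which give
  \<open>left_part p q r\<close>, and those of \<open>y\<close> from position \<open>j\<close> on,
  which give the rotated term.\<close>

lemma bracketL_path_bracket: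
  fixes p q r :: "('v, 'a + 'a) qpath"
  shows "bracketL (\<lambda>(x, y). word_bracket x y) (basis p) (path_bracket q r) =
     (left_part p q r - rotate3 (rotate3 (left_part r p q)) :: ('v, 'a + 'a, 'r::comm_ring_1) palg3)"
proof -
  obtain u x u' v y v' w z w' where [simp]: "p = (u, x, u')" "q = (v, y, v')" "r = (w, z, w')"
    by (metis prod_cases3)
  \<comment> \<open>In \<open>A\<close> the arrow of \<open>x\<close> is paired with one of
    \<open>z\<close>, in \<open>B\<close> with one of \<open>y\<close>; there \<open>n\<close> is an
    offset within \<open>drop j y\<close>.\<close>
  define A where "A i j k l = (
      scale (of_int (pairing (y ! j) (z ! k) * pairing (x ! i) (z ! l)))
        (basis (((w, take (Suc l) z @ drop i x, u'),
                 (u, take (Suc i) x @ drop l (take (Suc k) z) @ drop j y, v')),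
                (v, take (Suc j) y @ drop k z, w'))) :: ('v, 'a + 'a, 'r) palg3)" for i j k l
  define B where "B i j k n = (
      scale (of_int (pairing (y ! j) (z ! k) * pairing (x ! i) (y ! (j + n))))
        (basis (((w, take (Suc k) z @ take (Suc n) (drop j y) @ drop i x, u'),
                 (u, take (Suc i) x @ drop (j + n) y, v')),
                (v, take (Suc j) y @ drop k z, w'))) :: ('v, 'a + 'a, 'r) palg3)" for i j k n
  have term_eq: "scale (of_int (pairing (y ! j) (z ! k)))
      (path_bracket p (w, take (Suc k) z @ drop j y, v') \<otimes>
         basis (v, take (Suc j) y @ drop k z, w')) =
      (\<Sum>i<length x. \<Sum>l<Suc k. A i j k l) + (\<Sum>i<length x. \<Sum>n<length y - j. B i j k n)"
    if "j < length y" "k < length z" for j k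
  proof -
    have len: "length (take (Suc k) z) = Suc k"
      using that by simp
    have l: "take (Suc k) z ! l = z ! l" "take (Suc l) (take (Suc k) z) = take (Suc l) z"
      if "l < Suc k" for l
      using that by (simp_all add: min_absorb1)
    show ?thesis
      unfolding \<open>p = _\<close> path_bracket_append len
      using that by (simp add: tensor_add_left tensor_sum_left tensor_scale_left scale_add scale_sum
          scale_scale l A_def B_def add.commute del: sum.lessThan_Suc)
  qed
  have "bracketL (\<lambda>(x, y). word_bracket x y) (basis p) (path_bracket q r) =
      (\<Sum>j<length y. \<Sum>k<length z. scale (of_int (pairing (y ! j) (z ! k)))
        (path_bracket p (w, take (Suc k) z @ drop j y, v') \<otimes>
           basis (v, take (Suc j) y @ drop k z, w')))"
    by (simp add: bracketL_def lin_ext_sum lin_ext_scale del: \<open>p = _\<close>)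
  also have "\<dots> = (\<Sum>j<length y. \<Sum>k<length z. \<Sum>i<length x. \<Sum>l<Suc k. A i j k l) +
      (\<Sum>j<length y. \<Sum>k<length z. \<Sum>i<length x. \<Sum>n<length y - j. B i j k n)"
    by (simp add: term_eq sum.distrib del: sum.lessThan_Suc \<open>p = _\<close>)
  also have "(\<Sum>j<length y. \<Sum>k<length z. \<Sum>i<length x. \<Sum>l<Suc k. A i j k l) =
      (\<Sum>j<length y. \<Sum>i<length x. \<Sum>k<length z. \<Sum>l<Suc k. A i j k l)"
    by (intro sum.cong refl sum.swap)
  also have "\<dots> = (\<Sum>i<length x. \<Sum>j<length y. \<Sum>k<length z. \<Sum>l<Suc k. A i j k l)"
    by (rule sum.swap)
  also have "\<dots> = left_part p q r"
    by (simp add: A_def del: sum.lessThan_Suc)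
  also have "(\<Sum>j<length y. \<Sum>k<length z. \<Sum>i<length x. \<Sum>n<length y - j. B i j k n) =
      (\<Sum>k<length z. \<Sum>j<length y. \<Sum>i<length x. \<Sum>n<length y - j. B i j k n)"
    by (rule sum.swap)
  also have "\<dots> = (\<Sum>k<length z. \<Sum>i<length x. \<Sum>j<length y. \<Sum>n<length y - j. B i j k n)"
    by (intro sum.cong refl sum.swap)
  also have "\<dots> = (\<Sum>k<length z. \<Sum>i<length x. \<Sum>m<length y. \<Sum>j<Suc m. B i j k (m - j))"
    by (simp only: sum_triangle)
  also have "\<dots> = - rotate3 (rotate3 (left_part r p q))"
  proof -
    \<comment> \<open>Two rotations carry the first tensor factor to the last place. The sign comes
      from reversing the pairing of \<open>y ! j\<close> and \<open>z ! k\<close>. Since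
      \<open>j\<close> is at most \<open>m\<close>, the middle segment of \<open>y\<close> is
      \<open>drop j (take (Suc m) y)\<close>.\<close>
    have "B i j k (m - j) = - rotate3 (rotate3
        (scale (of_int (pairing (x ! i) (y ! m) * pairing (z ! k) (y ! j)))
          (basis (((v, take (Suc j) y @ drop k z, w'),
                   (w, take (Suc k) z @ drop j (take (Suc m) y) @ drop i x, u')),
                  (u, take (Suc i) x @ drop m y, v')))))"
      if "j < Suc m" for i j k m
      using that
      by (simp add: B_def rotate3_scale rotate3_minus drop_take Suc_diff_le pairing_antisym[of "z ! k"]
          module.scale_minus_left[OF module_scale] mult.commute)
    then show ?thesis
      by (simp add: rotate3_sum sum_negf del: sum.lessThan_Suc)
  qed
  finally show ?thesis by simp
qed

section \<open>Trilinearity and vanishing of the triple bracket\<close>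

lemma bracketL_add_right: "bracketL br x (s + t) = bracketL br x s + bracketL br x t"
  by (simp add: bracketL_def lin_ext_add)

lemma bracketL_scale_right: "bracketL br x (scale r t) = scale r (bracketL br x t)"
  by (simp add: bracketL_def lin_ext_scale)

lemma bracketL_word_bracket_add_left:
  "bracketL (\<lambda>(x, y). word_bracket x y) (x + y) t =
     bracketL (\<lambda>(x, y). word_bracket x y) x t + bracketL (\<lambda>(x, y). word_bracket x y) y t"
  by (simp add: bracketL_def word_bracket_add_left tensor_add_left split_def lin_ext_fun_add)

lemma bracketL_word_bracket_scale_left:
  "bracketL (\<lambda>(x, y). word_bracket x y) (scale r x) t =
     scale r (bracketL (\<lambda>(x, y). word_bracket x y) x t)"
  by (simp add: bracketL_def word_bracket_scale_left tensor_scale_left split_def lin_ext_fun_scale)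

lemma triple_bracket_word_bracket_add:
  "triple_bracket (\<lambda>(x, y). word_bracket x y) (x + x') y z =
     triple_bracket (\<lambda>(x, y). word_bracket x y) x y z + triple_bracket (\<lambda>(x, y). word_bracket x y) x' y z"
  "triple_bracket (\<lambda>(x, y). word_bracket x y) x (y + y') z =
     triple_bracket (\<lambda>(x, y). word_bracket x y) x y z + triple_bracket (\<lambda>(x, y). word_bracket x y) x y' z"
  "triple_bracket (\<lambda>(x, y). word_bracket x y) x y (z + z') =
     triple_bracket (\<lambda>(x, y). word_bracket x y) x y z + triple_bracket (\<lambda>(x, y). word_bracket x y) x y z'"
  by (simp_all add: triple_bracket_def bracketL_add_right bracketL_word_bracket_add_left
      word_bracket_add_left word_bracket_add_right rotate3_add algebra_simps)

lemma triple_bracket_word_bracket_scale: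
  "triple_bracket (\<lambda>(x, y). word_bracket x y) (scale r x) y z =
     scale r (triple_bracket (\<lambda>(x, y). word_bracket x y) x y z)"
  "triple_bracket (\<lambda>(x, y). word_bracket x y) x (scale r y) z =
     scale r (triple_bracket (\<lambda>(x, y). word_bracket x y) x y z)"
  "triple_bracket (\<lambda>(x, y). word_bracket x y) x y (scale r z) =
     scale r (triple_bracket (\<lambda>(x, y). word_bracket x y) x y z)"
  by (simp_all add: triple_bracket_def bracketL_scale_right bracketL_word_bracket_scale_left
      word_bracket_scale_left word_bracket_scale_right rotate3_scale scale_add)

lemma triple_bracket_word_bracket: "triple_bracket (\<lambda>(x, y). word_bracket x y) x y z = 0"
proof (induction x rule: basis_induct)
  case (basis p)
  show ?case
  proof (induction y rule: basis_induct)
    case (basis q)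
    show ?case
    proof (induction z rule: basis_induct)
      case (basis r)
      show ?case
        \<comment> \<open>Each of the three cyclic arrangements of \<open>left_part\<close> occurs
          twice with opposite signs; \<open>rotate3_cube\<close> matches the numbers of
          rotations.\<close>
        by (simp add: triple_bracket_def bracketL_path_bracket rotate3_diff)
    qed (simp_all add: triple_bracket_word_bracket_add triple_bracket_word_bracket_scale)
  qed (simp_all add: triple_bracket_word_bracket_add triple_bracket_word_bracket_scale)
qed (simp_all add: triple_bracket_word_bracket_add triple_bracket_word_bracket_scale)

lemma poisson_quiver_bracket:
  fixes Q :: "('v, 'a) pre_digraph"
  assumes Q: "wf_digraph Q"
  shows "poisson_double_bracket (double Q)
    (quiver_bracket Q :: ('v, 'a + 'a, 'r::comm_ring_1) bracket)"
proof -
  let ?br = "quiver_bracket Q :: ('v, 'a + 'a, 'r) bracket"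
  let ?A = "path_algebra (double Q) :: ('v, 'a + 'a, 'r) palg set"
  \<comment> \<open>Only basis vectors from the support of \<open>t\<close> enter, and their factors
    are paths, where both brackets agree.\<close>
  have L: "bracketL ?br x t = bracketL (\<lambda>(x, y). word_bracket x y) x t"
    if "x \<in> ?A" "t \<in> path_algebra2 (double Q)" for x t
    unfolding bracketL_def
  proof (rule lin_ext_cong, clarify)
    fix a b assume "(a, b) \<in> Poly_Mapping.keys t"
    then have "a \<in> paths (double Q)"
      using that(2) by (auto simp: path_algebra2_def free_module_def)
    then show "?br (x, basis a) \<otimes> basis b = word_bracket x (basis a) \<otimes> basis b"
      using that(1) by (simp add: quiver_bracket_def basis_mem_path_algebra)
  qed
  have "triple_bracket ?br x y z = triple_bracket (\<lambda>(x, y). word_bracket x y) x y z"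
    if "x \<in> ?A" "y \<in> ?A" "z \<in> ?A" for x y z
  proof -
    have "?br (y, z) = word_bracket y z" "?br (z, x) = word_bracket z x"
      "?br (x, y) = word_bracket x y"
      using that by (simp_all add: quiver_bracket_def)
    then show ?thesis
      using that by (simp add: triple_bracket_def L word_bracket_closed[OF Q])
  qed
  moreover have "plus_bracket Q ?br"
    using Q by (rule plus_bracket_quiver_bracket)
  ultimately show ?thesis
    by (simp add: poisson_double_bracket_def plus_bracket_def triple_bracket_word_bracket)
qed

theorem proposition3p1:
  fixes Q :: "('v, 'a) pre_digraph"
  assumes "fin_digraph Q"
  shows "(\<exists>!br :: ('v, 'a + 'a, 'r::comm_ring_1) bracket. plus_bracket Q br) \<and>
    (\<forall>br :: ('v, 'a + 'a, 'r) bracket.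
       plus_bracket Q br \<longrightarrow> poisson_double_bracket (double Q) br)"
proof -
  have Q: "wf_digraph Q"
    using assms by (rule fin_digraph.axioms(1))
  note plus = plus_bracket_quiver_bracket[OF Q] and uniq = plus_bracket_unique[OF Q]
  show ?thesis
  proof (intro conjI allI impI)
    show "\<exists>!br :: ('v, 'a + 'a, 'r) bracket. plus_bracket Q br"
      using plus uniq[OF _ plus] by (rule ex1I)
    show "poisson_double_bracket (double Q) br" if "plus_bracket Q br"
      for br :: "('v, 'a + 'a, 'r) bracket"
      \<comment> \<open>By uniqueness \<open>br\<close> is the explicit bracket, whose Poisson
        property is known.\<close>
      using poisson_quiver_bracket[OF Q] uniq[OF that plus] by simp
  qed
qed

end
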